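(* Let $p,q\ge1$, $d=p+q$, $\Sigma_1\in\mathbb{S}^p_\ge$ and $\Sigma_2\in\mathbb{S}^q_\ge$. Among all matrices $\Sigma\in\Gamma(\Sigma_1,\Sigma_2)$, the matrix $\Sigma_m$ (defined in the context) minimises the von Neumann entropy $$-\operatorname{tr}(\Sigma\ln\Sigma)=-\sum_{j=1}^d\lambda_j\ln\lambda_j,$$ where the sum is over all $d$ eigenvalues $\lambda_1,\dots,\lambda_d$ of $\Sigma$, counting multiplicities, and $\lambda\ln\lambda$ is interpreted as $0$ for $\lambda=0$.
   Context: $\mathbb{S}^m_{\ge}$ is the set of real symmetric positive semi-definite $m\times m$ matrices. $\Gamma(\Sigma_1,\Sigma_2)$ is the set of all $\Sigma\in\mathbb{S}^{p+q}_{\ge}$ with upper left $p\times p$ diagonal block $\Sigma_1$ and lower right $q\times q$ diagonal block $\Sigma_2$. Eigendecompositions: $\Sigma_j=U_j\Lambda_jU_j^\top$, $j\in\{1,2\}$, with $U_j$ orthogonal and $\Lambda_j$ diagonal containing the eigenvalues of $\Sigma_j$ in decreasing order (counting multiplicities). The matrix $\Sigma_m$ is $\Sigma_m=\begin{bmatrix}\Sigma_1&\Psi_m\\ \Psi_m^\top&\Sigma_2\end{bmatrix}$ with $\Psi_m=U_1\Lambda_1^{1/2}\Pi\Lambda_2^{1/2}U_2^\top$, where $\Pi\in\mathbb{R}^{p\times q}$ is the $p\times q$ upper left block of $I_d$; it belongs to $\Gamma(\Sigma_1,\Sigma_2)$. *)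

theory Defs
  imports Complex_Main "Jordan_Normal_Form.Char_Poly"
begin

definition psd_mats :: "nat \<Rightarrow> real mat set" where
  "psd_mats m = {A \<in> carrier_mat m m. transpose_mat A = A \<and>
     (\<forall>v \<in> carrier_vec m. v \<bullet> (A *\<^sub>v v) \<ge> 0)}"

definition Gamma_set :: "nat \<Rightarrow> nat \<Rightarrow> real mat \<Rightarrow> real mat \<Rightarrow> real mat set" where
  "Gamma_set p q S1 S2 =
     {S \<in> psd_mats (p + q). \<exists>B C. split_block S p p = (S1, B, C, S2)}"

(* The library's orthogonal_mat does not require normalised columns, so orthogonality is
   spelled out here. *)
definition orth_diagonalises :: "nat \<Rightarrow> real mat \<Rightarrow> real mat \<Rightarrow> real mat \<Rightarrow> bool" where
  "orth_diagonalises m A U L \<longleftrightarrow>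
     U \<in> carrier_mat m m \<and> transpose_mat U * U = 1\<^sub>m m \<and> U * transpose_mat U = 1\<^sub>m m \<and>
     L \<in> carrier_mat m m \<and> diagonal_mat L \<and>
     A = U * L * transpose_mat U"

definition ordered_eigendecomposition :: "nat \<Rightarrow> real mat \<Rightarrow> real mat \<Rightarrow> real mat \<Rightarrow> bool" where
  "ordered_eigendecomposition m A U L \<longleftrightarrow>
     orth_diagonalises m A U L \<and> (\<forall>i j. i \<le> j \<and> j < m \<longrightarrow> L $$ (j, j) \<le> L $$ (i, i))"

(* f applied to the diagonal entries only; diag_fun sqrt L is the square root of a
   non-negative diagonal matrix L. *)
definition diag_fun :: "(real \<Rightarrow> real) \<Rightarrow> real mat \<Rightarrow> real mat" where
  "diag_fun f L = mat_diag (dim_row L) (\<lambda>i. f (L $$ (i, i)))"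

(* Spectral functional calculus for symmetric A; U * diag_fun f L * U^T does not depend on
   the chosen eigendecomposition. *)
definition sym_mat_fun :: "(real \<Rightarrow> real) \<Rightarrow> real mat \<Rightarrow> real mat" where
  "sym_mat_fun f A = (THE B. \<exists>U L. orth_diagonalises (dim_row A) A U L \<and>
     B = U * diag_fun f L * transpose_mat U)"

definition x_ln_x :: "real \<Rightarrow> real" where
  "x_ln_x x = (if x = 0 then 0 else x * ln x)"

definition mat_tr :: "real mat \<Rightarrow> real" where
  "mat_tr A = (\<Sum>i<dim_row A. A $$ (i, i))"

(* S ln S is read as the spectral function x ln x of S, which also covers singular S. *)
definition vN_entropy :: "real mat \<Rightarrow> real" where
  "vN_entropy S = - mat_tr (sym_mat_fun x_ln_x S)"

(* Sum of f over the real eigenvalues, each weighted by its algebraic multiplicity. *)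
definition eigenvalue_sum :: "(real \<Rightarrow> real) \<Rightarrow> real mat \<Rightarrow> real" where
  "eigenvalue_sum f S =
     (\<Sum>x | eigenvalue S x. real (Polynomial.order x (char_poly S)) * f x)"

definition Pi_mat :: "nat \<Rightarrow> nat \<Rightarrow> real mat" where
  "Pi_mat p q = fst (split_block (1\<^sub>m (p + q)) p q)"

definition Psi_m :: "nat \<Rightarrow> nat \<Rightarrow> real mat \<Rightarrow> real mat \<Rightarrow> real mat \<Rightarrow> real mat \<Rightarrow> real mat" where
  "Psi_m p q U1 L1 U2 L2 =
     U1 * diag_fun sqrt L1 * Pi_mat p q * diag_fun sqrt L2 * transpose_mat U2"

definition Sigma_m :: "real mat \<Rightarrow> real mat \<Rightarrow> real mat \<Rightarrow> real mat" where
  "Sigma_m S1 S2 Psi = four_block_mat S1 Psi (transpose_mat Psi) S2"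

end

theory Submission
  imports Defs "Jordan_Normal_Form.Spectral_Radius"
begin

text \<open>
  Write $\lambda_1 \ge \lambda_2 \ge \dots$ for the spectrum of a competitor $S$, and let
  $\mu_j = \lambda_j(S_1) + \lambda_j(S_2)$, where a spectrum is continued by zeros beyond its
  length. The proof compares both sides with the numbers $\mu_j$.

  Every competitor has a spectrum majorised by $\mu$. Diagonalise $S = W D W^T$ and put
  $C = D^{1/2} W^T U$ with $U$ the block diagonal matrix of $U_1$ and $U_2$. The columns of $C$
  fall into two groups, each consisting of pairwise orthogonal vectors, with squared norms
  $\lambda_j(S_1)$ and $\lambda_j(S_2)$, while the squared norm of row $i$ is $D_{ii}$. Bessel's
  inequality shows that $k$ rows see at most $k$ units of mass of the normalised columns of one
  group, so the sum of $k$ diagonal entries of $D$ is at most $\mu_1 + \dots + \mu_k$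
  (\<open>spectrum_majorised_by_block_spectra\<close>, resting on \<open>row_mass_le_top_column_norms\<close>).
  Convexity of $x \ln x$, in the form of tangent lines combined with summation by parts, turns this
  into $\sum \lambda_i \ln \lambda_i \le \sum \mu_j \ln \mu_j$ (\<open>sum_x_ln_x_mono\<close>).

  The candidate attains this bound. It factors as $N N^T$ in such a way that $N^T N$ is diagonal
  with entries $\mu_j$ (\<open>Sigma_m_gram\<close>): the ordered decompositions align the eigenvectors
  of the two blocks, and a pair $(\lambda_j(S_1), \lambda_j(S_2))$ is merged into the
  eigenvalues $\mu_j$ and $0$. Since $N N^T$ and $N^T N$ have the same nonzero eigenvalues, the
  two sums agree (\<open>trace_fun_gram_swap\<close>).

  Eigendecompositions exist by \<open>real_spectral_theorem\<close>, and the entropy and the sum over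
  the eigenvalues can be read off from any of them (\<open>trace_sym_mat_fun\<close>,
  \<open>eigenvalue_sum_diag\<close>).
\<close>

section \<open>Matrix entries and orthogonal matrices\<close>

lemma mult_mat_entry:
  assumes "A \<in> carrier_mat n m" "B \<in> carrier_mat m r" "i < n" "j < r"
  shows "(A * B) $$ (i, j) = (\<Sum>k<m. A $$ (i, k) * B $$ (k, j))"
  using assms by (auto simp: scalar_prod_def atLeast0LessThan)

lemma mult_mat_vec_entry:
  assumes "A \<in> carrier_mat n m" "v \<in> carrier_vec m" "i < n"
  shows "(A *\<^sub>v v) $ i = (\<Sum>k<m. A $$ (i, k) * v $ k)"
  using assms by (auto simp: scalar_prod_def atLeast0LessThan)

definition orthogonal :: "nat \<Rightarrow> real mat \<Rightarrow> bool" where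
  "orthogonal m U \<longleftrightarrow> U \<in> carrier_mat m m \<and> transpose_mat U * U = 1\<^sub>m m \<and> U * transpose_mat U = 1\<^sub>m m"

lemma orthogonalD:
  assumes "orthogonal m U"
  shows "U \<in> carrier_mat m m" "transpose_mat U \<in> carrier_mat m m"
    "transpose_mat U * U = 1\<^sub>m m" "U * transpose_mat U = 1\<^sub>m m"
  using assms by (auto simp: orthogonal_def)

lemma orthogonal_col_sum:
  assumes "orthogonal m U" "i < m" "j < m"
  shows "(\<Sum>k<m. U $$ (k, i) * U $$ (k, j)) = (if i = j then 1 else 0)"
proof -
  note U = orthogonalD[OF assms(1)]
  have "(transpose_mat U * U) $$ (i, j) = (if i = j then 1 else 0)"
    using U(3) assms by simp
  then show ?thesis
    using U(1) assms by (subst (asm) mult_mat_entry[OF U(2,1)]) auto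
qed

lemma orthogonal_transpose: "orthogonal m U \<Longrightarrow> orthogonal m (transpose_mat U)"
  by (auto simp: orthogonal_def)

lemma orthogonal_mult:
  assumes "orthogonal m U" "orthogonal m V"
  shows "orthogonal m (U * V)"
proof -
  note U = orthogonalD[OF assms(1)] and V = orthogonalD[OF assms(2)]
  have "transpose_mat (U * V) * (U * V) = transpose_mat V * ((transpose_mat U * U) * V)"
    using U(1,2) V(1,2) by (simp add: transpose_mult[OF U(1) V(1)] assoc_mult_mat[of _ m m _ m _ m])
  also have "\<dots> = 1\<^sub>m m"
    unfolding U(3) using V by simp
  finally have 1: "transpose_mat (U * V) * (U * V) = 1\<^sub>m m" .
  have "(U * V) * transpose_mat (U * V) = U * ((V * transpose_mat V) * transpose_mat U)"
    using U(1,2) V(1,2) by (simp add: transpose_mult[OF U(1) V(1)] assoc_mult_mat[of _ m m _ m _ m])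
  also have "\<dots> = 1\<^sub>m m"
    unfolding V(4) using U by simp
  finally show ?thesis
    using 1 U V by (simp add: orthogonal_def)
qed

lemma orthogonal_block_diag:
  assumes "orthogonal p U" "orthogonal q V"
  shows "orthogonal (p + q) (four_block_mat U (0\<^sub>m p q) (0\<^sub>m q p) V)"
proof -
  note U = orthogonalD[OF assms(1)] and V = orthogonalD[OF assms(2)]
  let ?Z = "0\<^sub>m p q :: real mat" and ?Y = "0\<^sub>m q p :: real mat"
  have Z: "?Z \<in> carrier_mat p q" and Y: "?Y \<in> carrier_mat q p"
    by auto
  have t: "transpose_mat (four_block_mat U ?Z ?Y V) = four_block_mat (transpose_mat U) ?Z ?Y (transpose_mat V)"
    by (subst transpose_four_block_mat[OF U(1) Z Y V(1)]) simp
  show ?thesis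
    unfolding orthogonal_def t
    using U V
    by (simp add: mult_four_block_mat[OF U(2) Z Y V(2) U(1) Z Y V(1)]
          mult_four_block_mat[OF U(1) Z Y V(1) U(2) Z Y V(2)])
qed

lemma orth_diagonalises_iff:
  "orth_diagonalises m A U L \<longleftrightarrow> orthogonal m U \<and> L \<in> carrier_mat m m \<and> diagonal_mat L
     \<and> A = U * L * transpose_mat U"
  by (auto simp: orth_diagonalises_def orthogonal_def)

lemma conjugate_diag_entry:
  fixes U L :: "real mat"
  assumes "U \<in> carrier_mat m m" "L \<in> carrier_mat m m" "diagonal_mat L" "i < m" "j < m"
  shows "(U * L * transpose_mat U) $$ (i, j) = (\<Sum>k<m. L $$ (k, k) * (U $$ (i, k) * U $$ (j, k)))"
proof -
  have UL: "(U * L) $$ (i, k) = U $$ (i, k) * L $$ (k, k)" if "k < m" for k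
  proof -
    have "(U * L) $$ (i, k) = (\<Sum>l<m. U $$ (i, l) * L $$ (l, k))"
      using mult_mat_entry[OF assms(1,2,4)] that by simp
    also have "\<dots> = (\<Sum>l<m. if l = k then U $$ (i, k) * L $$ (k, k) else 0)"
      using assms that by (intro sum.cong) (auto simp: diagonal_mat_def)
    finally show ?thesis using that by simp
  qed
  have "(U * L * transpose_mat U) $$ (i, j) = (\<Sum>k<m. (U * L) $$ (i, k) * transpose_mat U $$ (k, j))"
    by (rule mult_mat_entry[of _ m m _ m]) (use assms in auto)
  also have "\<dots> = (\<Sum>k<m. L $$ (k, k) * (U $$ (i, k) * U $$ (j, k)))"
    by (intro sum.cong refl) (use assms in \<open>simp add: UL mult_ac del: index_mult_mat(1)\<close>)
  finally show ?thesis .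
qed

lemma transpose_conjugate:
  assumes "orthogonal m U" "L \<in> carrier_mat m m" "A = U * L * transpose_mat U"
  shows "transpose_mat U * A * U = L"
proof -
  note U = orthogonalD[OF assms(1)]
  have "transpose_mat U * A * U = (transpose_mat U * U) * L * (transpose_mat U * U)"
    unfolding assms(3) using U(1,2) assms(2) by (simp add: assoc_mult_mat[of _ m m _ m _ m])
  then show ?thesis unfolding U(3) using assms(2) by simp
qed

section \<open>The spectral theorem for real symmetric matrices\<close>

text \<open>
  A complex eigenvalue $k$ exists. The number $v^* A v = k\, v^* v$ is its own conjugate because
  $A$ is real and symmetric, so $k$ is real. Being a real root of the characteristic polynomial,
  it also has a real eigenvector.
\<close>

lemma symmetric_unit_eigenvector:
  fixes A :: "real mat"
  assumes A: "A \<in> carrier_mat n n" and sym: "transpose_mat A = A" and n: "n > 0"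
  shows "\<exists>r v. (\<Sum>i<n. (v i)\<^sup>2) = 1 \<and> (\<forall>i<n. (\<Sum>j<n. A $$ (i, j) * v j) = r * v i)"
proof -
  define B where "B = map_mat complex_of_real A"
  have B: "B \<in> carrier_mat n n" using A by (simp add: B_def)
  from spectrum_non_empty[OF B n] obtain k where k: "eigenvalue B k"
    by (auto simp: spectrum_def)
  then obtain v where v: "v \<in> carrier_vec n" "v \<noteq> 0\<^sub>v n" "B *\<^sub>v v = k \<cdot>\<^sub>v v"
    using B by (auto simp: eigenvalue_def eigenvector_def)
  have ev: "(\<Sum>j<n. of_real (A $$ (i, j)) * v $ j) = k * v $ i" if "i < n" for i
  proof -
    have "(\<Sum>j<n. of_real (A $$ (i, j)) * v $ j) = (B *\<^sub>v v) $ i"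
      using mult_mat_vec_entry[OF B v(1) that] that A by (simp add: B_def)
    then show ?thesis using v that by simp
  qed
  have symA: "A $$ (i, j) = A $$ (j, i)" if "i < n" "j < n" for i j
    using A sym that by (metis carrier_matD index_transpose_mat(1))
  define N where "N = (\<Sum>i<n. cnj (v $ i) * v $ i)"
  define z where "z = (\<Sum>i<n. cnj (v $ i) * (\<Sum>j<n. of_real (A $$ (i, j)) * v $ j))"
  have "z = (\<Sum>i<n. cnj (v $ i) * (k * v $ i))"
    unfolding z_def by (intro sum.cong) (auto simp: ev)
  then have z: "z = k * N"
    by (simp add: N_def sum_distrib_left mult_ac)
  have "cnj z = (\<Sum>i<n. \<Sum>j<n. v $ i * (of_real (A $$ (i, j)) * cnj (v $ j)))"
    by (simp add: z_def sum_distrib_left)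
  also have "\<dots> = (\<Sum>j<n. \<Sum>i<n. v $ i * (of_real (A $$ (i, j)) * cnj (v $ j)))"
    by (rule sum.swap)
  also have "\<dots> = z"
    unfolding z_def sum_distrib_left by (intro sum.cong) (auto simp: symA)
  finally have cz: "cnj z = z" .
  have N: "N = of_real (\<Sum>i<n. (cmod (v $ i))\<^sup>2)"
    unfolding N_def of_real_sum by (intro sum.cong refl) (metis complex_norm_square mult.commute)
  have "N \<noteq> 0"
  proof
    assume "N = 0"
    then have "(\<Sum>i<n. (cmod (v $ i))\<^sup>2) = 0" using N of_real_eq_0_iff by metis
    then have "\<forall>i<n. v $ i = 0" by (subst (asm) sum_nonneg_eq_0_iff) auto
    then show False using v by auto
  qed
  have "cnj N = N" by (simp add: N)
  then have "cnj k = k" using cz \<open>N \<noteq> 0\<close> by (simp add: z)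
  then obtain r where r: "k = of_real r"
    by (metis Reals_cnj_iff Reals_cases)
  have "poly (char_poly B) k = 0" using k eigenvalue_root_char_poly[OF B] by simp
  then have "of_real (poly (char_poly A) r) = (0 :: complex)"
    unfolding B_def of_real_hom.char_poly_hom[OF A] r by simp
  then have "eigenvalue A r" using eigenvalue_root_char_poly[OF A] by simp
  then obtain u where u: "u \<in> carrier_vec n" "u \<noteq> 0\<^sub>v n" "A *\<^sub>v u = r \<cdot>\<^sub>v u"
    using A by (auto simp: eigenvalue_def eigenvector_def)
  define s where "s = (\<Sum>i<n. (u $ i)\<^sup>2)"
  have "s \<noteq> 0"
  proof
    assume "s = 0"
    then have "\<forall>i<n. u $ i = 0" unfolding s_def by (subst (asm) sum_nonneg_eq_0_iff) auto
    then show False using u by auto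
  qed
  moreover have "s \<ge> 0" by (simp add: s_def sum_nonneg)
  ultimately have s: "s > 0" by simp
  have evu: "(\<Sum>j<n. A $$ (i, j) * u $ j) = r * u $ i" if "i < n" for i
    using mult_mat_vec_entry[OF A u(1) that] u that by simp
  have 1: "(\<Sum>i<n. (u $ i / sqrt s)\<^sup>2) = 1"
    using s by (simp add: power_divide sum_divide_distrib[symmetric] s_def[symmetric])
  have 2: "(\<Sum>j<n. A $$ (i, j) * (u $ j / sqrt s)) = r * (u $ i / sqrt s)" if "i < n" for i
    using evu[OF that] by (simp add: sum_divide_distrib[symmetric])
  show ?thesis
    by (rule exI[of _ r], rule exI[of _ "\<lambda>i. u $ i / sqrt s"]) (use 1 2 in blast)
qed

text \<open>
  The reflection that exchanges the first basis vector $e$ with $v$. Because $v$ is a unit vector,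
  $w = e - v$ has squared norm $2 w_0$, so the factor $2 / \|w\|^2$ of the reflection is $1 / w_0$.
  For $v = e$ the convention $x / 0 = 0$ makes the formula yield the identity, as it should.
\<close>

lemma householder:
  fixes v :: "nat \<Rightarrow> real"
  assumes n: "n > 0" and unit: "(\<Sum>i<n. (v i)\<^sup>2) = 1"
  shows "\<exists>H. orthogonal n H \<and> transpose_mat H = H \<and> (\<forall>i<n. H $$ (i, 0) = v i)"
proof -
  define w where "w i = (if i = 0 then 1 else 0) - v i" for i :: nat
  define H where "H = mat n n (\<lambda>(i, j). (if i = j then 1 else 0) - w i * w j / w 0)"
  have H: "H \<in> carrier_mat n n" by (simp add: H_def)
  have Hs: "transpose_mat H = H" by (rule eq_matI) (auto simp: H_def mult.commute)
  have ww: "(\<Sum>k<n. w k * w k) = 2 * w 0"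
  proof -
    have "(\<Sum>k<n. w k * w k) = (\<Sum>k<n. (if k = 0 then 1 - 2 * v 0 else 0) + (v k)\<^sup>2)"
      by (intro sum.cong) (auto simp: w_def power2_eq_square algebra_simps)
    then show ?thesis using n unit by (simp add: sum.distrib w_def)
  qed
  have w0: "w i = 0" if "w 0 = 0" "i < n" for i
  proof -
    have "(\<Sum>k<n. w k * w k) = 0" using ww that by simp
    then show ?thesis using that by (subst (asm) sum_nonneg_eq_0_iff) auto
  qed
  have HH: "H * H = 1\<^sub>m n"
  proof (rule eq_matI)
    fix i j assume ij: "i < dim_row (1\<^sub>m n :: real mat)" "j < dim_col (1\<^sub>m n :: real mat)"
    then have ij': "i < n" "j < n" by auto
    have "(H * H) $$ (i, j) = (\<Sum>k<n. H $$ (i, k) * H $$ (k, j))"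
      by (rule mult_mat_entry[OF H H ij'])
    also have "\<dots> = (\<Sum>k<n. (if k = i then (if i = j then 1 else 0) - w i * w j / w 0 else 0)
        - (if k = j then w i * w j / w 0 else 0) + w k * w k * (w i * w j / (w 0)\<^sup>2))"
      using ij' by (intro sum.cong) (auto simp: H_def algebra_simps power2_eq_square)
    also have "\<dots> = (if i = j then 1 else 0) - 2 * (w i * w j / w 0)
        + (\<Sum>k<n. w k * w k) * (w i * w j / (w 0)\<^sup>2)"
      using ij' by (simp add: sum.distrib sum_subtractf sum_distrib_right sum_divide_distrib)
    also have "\<dots> = (if i = j then 1 else 0)"
      unfolding ww by (cases "w 0 = 0") (auto simp: power2_eq_square)
    finally show "(H * H) $$ (i, j) = 1\<^sub>m n $$ (i, j)" using ij' by simp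
  qed (use H in auto)
  have "H $$ (i, 0) = v i" if "i < n" for i
    using that n w0[of i] by (cases "w 0 = 0") (auto simp: H_def w_def)
  then show ?thesis
    using H Hs HH by (intro exI[of _ H]) (simp add: orthogonal_def)
qed

text \<open>
  Conjugation with a reflection whose first column is an eigenvector clears the first column of $A$
  below the diagonal, hence by symmetry also the first row; the induction hypothesis applies to the
  remaining block.
\<close>

theorem real_spectral_theorem:
  fixes A :: "real mat"
  assumes "A \<in> carrier_mat n n" and "transpose_mat A = A"
  shows "\<exists>U L. orth_diagonalises n A U L"
  using assms
proof (induction n arbitrary: A)
  case 0
  then have "orth_diagonalises 0 A (1\<^sub>m 0) (1\<^sub>m 0)"
    by (auto simp: orth_diagonalises_def diagonal_mat_def intro!: eq_matI)
  then show ?case by blast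
next
  case (Suc n)
  note A = Suc.prems(1)
  obtain r v where v: "(\<Sum>i<Suc n. (v i)\<^sup>2) = 1"
    and ev: "\<And>i. i < Suc n \<Longrightarrow> (\<Sum>j<Suc n. A $$ (i, j) * v j) = r * v i"
    using symmetric_unit_eigenvector[OF Suc.prems] by blast
  obtain H where oH: "orthogonal (Suc n) H" and Hs: "transpose_mat H = H"
    and Hv: "\<And>i. i < Suc n \<Longrightarrow> H $$ (i, 0) = v i"
    using householder[OF _ v] by blast
  note H = orthogonalD[OF oH, unfolded Hs]
  define B where "B = H * (A * H)"
  have AH: "A * H \<in> carrier_mat (Suc n) (Suc n)" using A H by auto
  have B: "B \<in> carrier_mat (Suc n) (Suc n)" using AH H by (auto simp: B_def)
  have Bs: "transpose_mat B = B"
    unfolding B_def using transpose_mult[OF H(1) AH] transpose_mult[OF A H(1)] A H(1) Suc.prems(2) Hs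
    by (simp add: assoc_mult_mat[of _ "Suc n" "Suc n" _ "Suc n" _ "Suc n"])
  have B0: "B $$ (i, 0) = (if i = 0 then r else 0)" if "i < Suc n" for i
  proof -
    have AHe: "(A * H) $$ (k, 0) = r * H $$ (k, 0)" if "k < Suc n" for k
    proof -
      have "(A * H) $$ (k, 0) = (\<Sum>j<Suc n. A $$ (k, j) * H $$ (j, 0))"
        by (rule mult_mat_entry[OF A H(1) that]) simp
      also have "\<dots> = (\<Sum>j<Suc n. A $$ (k, j) * v j)"
        by (intro sum.cong) (auto simp: Hv)
      finally show ?thesis using ev that Hv by simp
    qed
    have "B $$ (i, 0) = (\<Sum>k<Suc n. H $$ (i, k) * (A * H) $$ (k, 0))"
      unfolding B_def by (rule mult_mat_entry[OF H(1) AH that]) simp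
    also have "\<dots> = r * (\<Sum>k<Suc n. H $$ (i, k) * H $$ (k, 0))"
      unfolding sum_distrib_left by (intro sum.cong) (auto simp: AHe)
    also have "(\<Sum>k<Suc n. H $$ (i, k) * H $$ (k, 0)) = (H * H) $$ (i, 0)"
      by (rule mult_mat_entry[OF H(1,1) that, symmetric]) simp
    finally show ?thesis using H(3) that by simp
  qed
  have B0': "B $$ (0, i) = (if i = 0 then r else 0)" if "i < Suc n" for i
    using B0[OF that] B Bs that by (metis carrier_matD index_transpose_mat(1) zero_less_Suc)
  define C where "C = mat n n (\<lambda>(i, j). B $$ (Suc i, Suc j))"
  have C: "C \<in> carrier_mat n n" by (simp add: C_def)
  have "transpose_mat C = C"
  proof (rule eq_matI)
    fix i j assume "i < dim_row C" "j < dim_col C"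
    then show "transpose_mat C $$ (i, j) = C $$ (i, j)"
      using B Bs index_transpose_mat(1)[of "Suc i" B "Suc j"] by (auto simp: C_def)
  qed (auto simp: C_def)
  from Suc.IH[OF C this] obtain U L where "orth_diagonalises n C U L" by blast
  then have oU: "orthogonal n U" and L: "L \<in> carrier_mat n n" and dL: "diagonal_mat L"
    and CUL: "C = U * L * transpose_mat U"
    by (auto simp: orth_diagonalises_iff)
  note U = orthogonalD[OF oU]
  let ?Z = "0\<^sub>m 1 n :: real mat" and ?Y = "0\<^sub>m n 1 :: real mat" and ?I = "1\<^sub>m 1 :: real mat"
  let ?r = "mat 1 1 (\<lambda>_. r)"
  have car: "?Z \<in> carrier_mat 1 n" "?Y \<in> carrier_mat n 1" "?I \<in> carrier_mat 1 1" "?r \<in> carrier_mat 1 1"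
    by auto
  define V where "V = four_block_mat ?I ?Z ?Y U"
  define M where "M = four_block_mat ?r ?Z ?Y L"
  have "orthogonal 1 ?I" by (simp add: orthogonal_def)
  from orthogonal_block_diag[OF this oU] have oV: "orthogonal (Suc n) V" by (simp add: V_def)
  note V = orthogonalD[OF oV]
  have M: "M \<in> carrier_mat (Suc n) (Suc n)" using L by (simp add: M_def four_block_mat_def)
  have dM: "diagonal_mat M" using L dL by (auto simp: M_def diagonal_mat_def)
  have Vt: "transpose_mat V = four_block_mat ?I ?Z ?Y (transpose_mat U)"
    unfolding V_def by (subst transpose_four_block_mat[OF car(3,1,2) U(1)]) simp
  have VM: "V * M = four_block_mat ?r ?Z ?Y (U * L)"
    unfolding V_def M_def
    using mult_four_block_mat[OF car(3,1,2) U(1) car(4,1,2) L] U(1) L car by simp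
  have "V * M * transpose_mat V = four_block_mat ?r ?Z ?Y C"
    unfolding VM Vt CUL
    using mult_four_block_mat[OF car(4,1,2) mult_carrier_mat[OF U(1) L] car(3,1,2) U(2)] U(1,2) L car
    by simp
  also have "\<dots> = B"
  proof (rule eq_matI)
    fix i j assume "i < dim_row B" "j < dim_col B"
    then show "four_block_mat ?r ?Z ?Y C $$ (i, j) = B $$ (i, j)"
      using B B0[of i] B0'[of j] C by (cases i; cases j) (auto simp: C_def)
  qed (use B C in auto)
  finally have BV: "B = V * M * transpose_mat V" by simp
  have "(H * V) * M * transpose_mat (H * V) = H * (V * M * transpose_mat V) * H"
    using transpose_mult[OF H(1) V(1)] Hs H(1) V(1,2) M
    by (simp add: assoc_mult_mat[of _ "Suc n" "Suc n" _ "Suc n" _ "Suc n"])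
  also have "\<dots> = (H * H) * A * (H * H)"
    unfolding BV[symmetric] B_def using H(1) A
    by (simp add: assoc_mult_mat[of _ "Suc n" "Suc n" _ "Suc n" _ "Suc n"])
  also have "\<dots> = A" using H(3) A by simp
  finally have "orth_diagonalises (Suc n) A (H * V) M"
    using orthogonal_mult[OF oH oV] M dM by (simp add: orth_diagonalises_iff)
  then show ?case by blast
qed

section \<open>Entropy in terms of an eigendecomposition\<close>

lemma diag_fun_carrier: "L \<in> carrier_mat m m \<Longrightarrow> diag_fun f L \<in> carrier_mat m m"
  by (simp add: diag_fun_def)

lemma diag_fun_entry:
  "L \<in> carrier_mat m m \<Longrightarrow> i < m \<Longrightarrow> j < m \<Longrightarrow>
    diag_fun f L $$ (i, j) = (if i = j then f (L $$ (i, i)) else 0)"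
  by (auto simp: diag_fun_def mat_diag_def)

lemma diagonal_diag_fun: "L \<in> carrier_mat m m \<Longrightarrow> diagonal_mat (diag_fun f L)"
  by (auto simp: diag_fun_def mat_diag_def diagonal_mat_def)

lemma diag_mult_left_entry:
  fixes L Q :: "real mat"
  assumes "L \<in> carrier_mat m m" "diagonal_mat L" "Q \<in> carrier_mat m n" "i < m" "j < n"
  shows "(L * Q) $$ (i, j) = L $$ (i, i) * Q $$ (i, j)"
proof -
  have "(L * Q) $$ (i, j) = (\<Sum>l<m. L $$ (i, l) * Q $$ (l, j))"
    using mult_mat_entry[OF assms(1,3,4,5)] .
  also have "\<dots> = (\<Sum>l<m. if l = i then L $$ (i, i) * Q $$ (i, j) else 0)"
    using assms by (intro sum.cong) (auto simp: diagonal_mat_def)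
  finally show ?thesis using assms by simp
qed

lemma diag_mult_right_entry:
  fixes L Q :: "real mat"
  assumes "L \<in> carrier_mat n n" "diagonal_mat L" "Q \<in> carrier_mat m n" "i < m" "j < n"
  shows "(Q * L) $$ (i, j) = Q $$ (i, j) * L $$ (j, j)"
proof -
  have "(Q * L) $$ (i, j) = (\<Sum>l<n. Q $$ (i, l) * L $$ (l, j))"
    using mult_mat_entry[OF assms(3,1,4,5)] .
  also have "\<dots> = (\<Sum>l<n. if l = j then Q $$ (i, j) * L $$ (j, j) else 0)"
    using assms by (intro sum.cong) (auto simp: diagonal_mat_def)
  finally show ?thesis using assms by simp
qed

text \<open>
  With $Q = V^T U$ one has $M Q = Q L$, so $Q_{ij} \ne 0$ forces $M_{ii} = L_{jj}$. Therefore
  $f(M) Q = Q f(L)$ for every function $f$. This gives the definite description in the functional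
  calculus a unique witness.
\<close>

lemma spectral_calculus_unique:
  assumes "orth_diagonalises m A U L" "orth_diagonalises m A V M"
  shows "U * diag_fun f L * transpose_mat U = V * diag_fun f M * transpose_mat V"
proof -
  have oU: "orthogonal m U" and L: "L \<in> carrier_mat m m" "diagonal_mat L"
    and AL: "A = U * L * transpose_mat U" using assms(1) by (auto simp: orth_diagonalises_iff)
  have oV: "orthogonal m V" and M: "M \<in> carrier_mat m m" "diagonal_mat M"
    and AM: "A = V * M * transpose_mat V" using assms(2) by (auto simp: orth_diagonalises_iff)
  note U = orthogonalD[OF oU] and V = orthogonalD[OF oV]
  note fL = diag_fun_carrier[OF L(1), of f] and fM = diag_fun_carrier[OF M(1), of f]
  note ass = assoc_mult_mat[of _ m m _ m _ m]
  define Q where "Q = transpose_mat V * U"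
  have Q: "Q \<in> carrier_mat m m" using U V by (auto simp: Q_def)
  have A: "A \<in> carrier_mat m m" unfolding AL using U L by auto
  have "transpose_mat V * A * U = M * Q"
  proof -
    have "transpose_mat V * A * U = (transpose_mat V * V) * (M * (transpose_mat V * U))"
      unfolding AM using U(1,2) V(1,2) M(1) by (simp add: ass)
    then show ?thesis unfolding V(3) Q_def using M(1) U(1,2) V(1,2) by simp
  qed
  moreover have "transpose_mat V * A * U = Q * L"
  proof -
    have "transpose_mat V * A * U = (transpose_mat V * U) * L * (transpose_mat U * U)"
      unfolding AL using U(1,2) V(1,2) L(1) by (simp add: ass)
    then show ?thesis unfolding U(3) Q_def using L(1) U(1,2) V(1,2) by simp
  qed
  ultimately have MQ: "M * Q = Q * L" by simp
  have eq: "diag_fun f M * Q = Q * diag_fun f L"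
  proof (rule eq_matI)
    fix i j assume "i < dim_row (Q * diag_fun f L)" "j < dim_col (Q * diag_fun f L)"
    then have ij: "i < m" "j < m" using Q fL by auto
    have "M $$ (i, i) * Q $$ (i, j) = Q $$ (i, j) * L $$ (j, j)"
      using MQ diag_mult_left_entry[OF M Q ij] diag_mult_right_entry[OF L Q ij] by metis
    then have "Q $$ (i, j) = 0 \<or> M $$ (i, i) = L $$ (j, j)" by auto
    then show "(diag_fun f M * Q) $$ (i, j) = (Q * diag_fun f L) $$ (i, j)"
      using diag_mult_left_entry[OF fM diagonal_diag_fun[OF M(1)] Q ij]
        diag_mult_right_entry[OF fL diagonal_diag_fun[OF L(1)] Q ij]
        diag_fun_entry[OF M(1) ij(1,1)] diag_fun_entry[OF L(1) ij(2,2)] by auto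
  qed (use Q fL fM in auto)
  have "U * diag_fun f L * transpose_mat U = (V * transpose_mat V) * U * diag_fun f L * transpose_mat U"
    unfolding V(4) using U(1) by simp
  also have "\<dots> = V * (Q * diag_fun f L) * transpose_mat U"
    unfolding Q_def using U(1,2) V(1,2) fL by (simp add: ass)
  also have "\<dots> = V * diag_fun f M * transpose_mat V * (U * transpose_mat U)"
    unfolding eq[symmetric] unfolding Q_def using U(1,2) V(1,2) fM by (simp add: ass)
  also have "\<dots> = V * diag_fun f M * transpose_mat V"
    unfolding U(4) using V(1,2) fM by simp
  finally show ?thesis .
qed

lemma trace_sym_mat_fun:
  assumes "orth_diagonalises m A U L"
  shows "mat_tr (sym_mat_fun f A) = (\<Sum>i<m. f (L $$ (i, i)))"
proof -
  have oU: "orthogonal m U" and L: "L \<in> carrier_mat m m" "diagonal_mat L"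
    and AL: "A = U * L * transpose_mat U" using assms(1) by (auto simp: orth_diagonalises_iff)
  note U = orthogonalD[OF oU]
  have dA: "dim_row A = m" unfolding AL using U by auto
  have "sym_mat_fun f A = U * diag_fun f L * transpose_mat U"
    unfolding sym_mat_fun_def dA
    by (rule the_equality) (use assms spectral_calculus_unique[OF _ assms] in blast)+
  then have "mat_tr (sym_mat_fun f A) = (\<Sum>i<m. (U * diag_fun f L * transpose_mat U) $$ (i, i))"
    using U by (simp add: mat_tr_def)
  also have "\<dots> = (\<Sum>i<m. \<Sum>k<m. f (L $$ (k, k)) * (U $$ (i, k) * U $$ (i, k)))"
    by (intro sum.cong refl, subst conjugate_diag_entry[OF U(1) diag_fun_carrier[OF L(1)] diagonal_diag_fun[OF L(1)]])
      (auto simp: diag_fun_entry[OF L(1)])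
  also have "\<dots> = (\<Sum>k<m. f (L $$ (k, k)) * (\<Sum>i<m. U $$ (i, k) * U $$ (i, k)))"
    unfolding sum_distrib_left by (rule sum.swap)
  also have "\<dots> = (\<Sum>k<m. f (L $$ (k, k)))"
    by (intro sum.cong) (auto simp: orthogonal_col_sum[OF oU])
  finally show ?thesis .
qed

lemma eigenvalue_sum_diag:
  assumes "orth_diagonalises m A U L"
  shows "eigenvalue_sum f A = (\<Sum>i<m. f (L $$ (i, i)))"
proof -
  have oU: "orthogonal m U" and L: "L \<in> carrier_mat m m" "diagonal_mat L"
    and AL: "A = U * L * transpose_mat U" using assms(1) by (auto simp: orth_diagonalises_iff)
  note U = orthogonalD[OF oU]
  have A: "A \<in> carrier_mat m m" unfolding AL using U L by auto
  have "similar_mat_wit A L U (transpose_mat U)"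
    by (rule similar_mat_witI[OF U(4,3) AL A L(1) U(1,2)])
  then have "char_poly A = char_poly L"
    by (intro char_poly_similar) (auto simp: similar_mat_def)
  also have "\<dots> = (\<Prod>a\<leftarrow>diag_mat L. [:- a, 1:])"
    by (rule char_poly_upper_triangular[OF L(1)]) (use L in \<open>auto simp: diagonal_mat_def\<close>)
  also have "diag_mat L = map (\<lambda>i. L $$ (i, i)) [0..<m]"
    using L by (simp add: diag_mat_def)
  finally have cp: "char_poly A = prod_list (map (\<lambda>i. [:- L $$ (i, i), 1:]) [0..<m])"
    by (simp add: o_def)
  have ord: "Polynomial.order x (char_poly A) = card {i \<in> {..<m}. L $$ (i, i) = x}" for x
  proof -
    have "Polynomial.order x (char_poly A) = (\<Sum>i\<leftarrow>[0..<m]. if L $$ (i, i) = x then 1 else 0)"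
      unfolding cp by (subst order_prod_list) (auto simp: o_def order_linear' intro!: arg_cong[of _ _ sum_list])
    also have "\<dots> = (\<Sum>i<m. if L $$ (i, i) = x then 1 else 0)"
      by (simp add: sum_list_distinct_conv_sum_set atLeast0LessThan)
    also have "\<dots> = card {i \<in> {..<m}. L $$ (i, i) = x}"
      by (simp add: sum.If_cases Int_def)
    finally show ?thesis .
  qed
  have ev: "{x. eigenvalue A x} = (\<lambda>i. L $$ (i, i)) ` {..<m}"
    unfolding eigenvalue_root_char_poly[OF A] cp
    by (auto simp: poly_prod_list prod_list_zero_iff)
  have "eigenvalue_sum f A = (\<Sum>x\<in>(\<lambda>i. L $$ (i, i)) ` {..<m}. \<Sum>i\<in>{i \<in> {..<m}. L $$ (i, i) = x}. f (L $$ (i, i)))"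
    unfolding eigenvalue_sum_def ev ord by (intro sum.cong) auto
  also have "\<dots> = (\<Sum>i<m. f (L $$ (i, i)))"
    by (rule sum.image_gen[symmetric]) simp
  finally show ?thesis .
qed

lemma psd_diag_nonneg:
  assumes "A \<in> psd_mats m" "orth_diagonalises m A U L" "i < m"
  shows "L $$ (i, i) \<ge> 0"
proof -
  have oU: "orthogonal m U" and L: "L \<in> carrier_mat m m" "diagonal_mat L"
    and AL: "A = U * L * transpose_mat U" using assms(2) by (auto simp: orth_diagonalises_iff)
  note U = orthogonalD[OF oU]
  have A: "A \<in> carrier_mat m m" using assms(1) by (simp add: psd_mats_def)
  have AU: "A * U \<in> carrier_mat m m" using A U by auto
  have "L = transpose_mat U * (A * U)"
    using transpose_conjugate[OF oU L(1) AL] A U(1,2) by (simp add: assoc_mult_mat[of _ m m _ m _ m])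
  then have "L $$ (i, i) = row (transpose_mat U) i \<bullet> col (A * U) i"
    using U(1) A assms(3) by simp
  also have "\<dots> = col U i \<bullet> (A *\<^sub>v col U i)"
    using U(1) A assms(3) by (simp add: col_mult2[OF A U(1) assms(3)])
  also have "\<dots> \<ge> 0"
    using assms(1,3) U(1) by (simp add: psd_mats_def)
  finally show ?thesis .
qed

text \<open>
  The matrices $N N^T$ and $N^T N$ have the same nonzero spectrum, zeros being invisible to functions
  of the form $x\, g(x)$. The proof avoids multiplicities: for $Q = W^T N$ both $Q Q^T = D$ and
  $Q^T Q = \mathrm{diag}(\mu)$, and $D Q = Q\, \mathrm{diag}(\mu)$ shows that $D_{ii} = \mu_j$
  wherever $Q_{ij} \ne 0$. Both sides are then $\sum_{i,j} Q_{ij}^2\, g$.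
\<close>

lemma trace_fun_gram_swap:
  fixes N :: "real mat" and \<mu> :: "nat \<Rightarrow> real"
  assumes od: "orth_diagonalises m (N * transpose_mat N) W D"
    and N: "N \<in> carrier_mat m n"
    and gram: "\<And>i j. i < n \<Longrightarrow> j < n \<Longrightarrow> (transpose_mat N * N) $$ (i, j) = (if i = j then \<mu> i else 0)"
  shows "(\<Sum>i<m. D $$ (i, i) * g (D $$ (i, i))) = (\<Sum>j<n. \<mu> j * g (\<mu> j))"
proof -
  have oW: "orthogonal m W" and D: "D \<in> carrier_mat m m" "diagonal_mat D"
    and AD: "N * transpose_mat N = W * D * transpose_mat W" using od by (auto simp: orth_diagonalises_iff)
  note W = orthogonalD[OF oW]
  have Nt: "transpose_mat N \<in> carrier_mat n m" using N by simp
  define Q where "Q = transpose_mat W * N"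
  have Q: "Q \<in> carrier_mat m n" using W N by (auto simp: Q_def)
  have Qt: "transpose_mat Q = transpose_mat N * W"
    unfolding Q_def using transpose_mult[OF W(2) N] by simp
  define M where "M = transpose_mat N * N"
  have M: "M \<in> carrier_mat n n" using N by (simp add: M_def)
  have dM: "diagonal_mat M" using gram M by (auto simp: diagonal_mat_def M_def)
  have Mmu: "M $$ (j, j) = \<mu> j" if "j < n" for j using gram that by (simp add: M_def)
  have QQ: "Q * transpose_mat Q = D"
  proof -
    have "Q * transpose_mat Q = transpose_mat W * (N * transpose_mat N) * W"
      unfolding Qt unfolding Q_def using W(1,2) N Nt
      by (simp add: assoc_mult_mat[of _ m m _ m _ m] assoc_mult_mat[of _ m m _ n _ m]
          assoc_mult_mat[of _ m n _ m _ m] assoc_mult_mat[of _ n m _ m _ m])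
    then show ?thesis using transpose_conjugate[OF oW D(1) AD] by simp
  qed
  have QtQ: "transpose_mat Q * Q = M"
  proof -
    have "transpose_mat Q * Q = transpose_mat N * ((W * transpose_mat W) * N)"
      unfolding Qt unfolding Q_def using W(1,2) N Nt
      by (simp add: assoc_mult_mat[of _ n m _ m _ n] assoc_mult_mat[of _ m m _ m _ n])
    then show ?thesis unfolding W(4) M_def using N by simp
  qed
  have Qt': "transpose_mat Q \<in> carrier_mat n m" using Q by simp
  have "D * Q = Q * M"
    unfolding QQ[symmetric] QtQ[symmetric] by (rule assoc_mult_mat[OF Q Qt' Q])
  then have link: "D $$ (i, i) = \<mu> j \<or> Q $$ (i, j) = 0" if "i < m" "j < n" for i j
    using diag_mult_left_entry[OF D Q that] diag_mult_right_entry[OF M dM Q that] Mmu that by auto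
  have Di: "D $$ (i, i) = (\<Sum>j<n. (Q $$ (i, j))\<^sup>2)" if "i < m" for i
    unfolding QQ[symmetric] using mult_mat_entry[OF Q Qt' that that] Q that
    by (simp add: power2_eq_square)
  have Mj: "\<mu> j = (\<Sum>i<m. (Q $$ (i, j))\<^sup>2)" if "j < n" for j
    unfolding Mmu[OF that, symmetric] QtQ[symmetric] using mult_mat_entry[OF Qt' Q that that] Q that
    by (simp add: power2_eq_square)
  have "(\<Sum>i<m. D $$ (i, i) * g (D $$ (i, i))) = (\<Sum>i<m. \<Sum>j<n. (Q $$ (i, j))\<^sup>2 * g (D $$ (i, i)))"
    by (intro sum.cong refl) (simp add: Di[symmetric] sum_distrib_right[symmetric])
  also have "\<dots> = (\<Sum>i<m. \<Sum>j<n. (Q $$ (i, j))\<^sup>2 * g (\<mu> j))"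
    by (intro sum.cong refl) (use link in force)
  also have "\<dots> = (\<Sum>j<n. \<Sum>i<m. (Q $$ (i, j))\<^sup>2 * g (\<mu> j))"
    by (rule sum.swap)
  also have "\<dots> = (\<Sum>j<n. \<mu> j * g (\<mu> j))"
    by (intro sum.cong refl) (simp add: Mj[symmetric] sum_distrib_right[symmetric])
  finally show ?thesis .
qed

section \<open>Majorisation of the spectrum by the sum of the block spectra\<close>

text \<open>
  After subtracting the constant $a_k$ the weights are nonnegative for $j < k$ and nonpositive from
  $k$ on, so the choice $T_j = 1$ for $j < k$ and $T_j = 0$ otherwise is optimal.
\<close>

lemma weighted_sum_le_top_sum:
  fixes a T :: "nat \<Rightarrow> real"
  assumes dec: "\<And>i j. i \<le> j \<Longrightarrow> j < n \<Longrightarrow> a j \<le> a i" and nonneg: "\<And>j. j < n \<Longrightarrow> 0 \<le> a j"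
    and T: "\<And>j. j < n \<Longrightarrow> 0 \<le> T j" "\<And>j. j < n \<Longrightarrow> T j \<le> 1"
    and sumT: "(\<Sum>j<n. T j) \<le> real k" and k: "k \<le> n"
  shows "(\<Sum>j<n. a j * T j) \<le> (\<Sum>j<k. a j)"
proof (cases "k = n")
  case True
  then show ?thesis
    using nonneg T by (auto intro!: sum_mono mult_left_le)
next
  case False
  then have kn: "k < n" using k by simp
  have "(\<Sum>j<n. (a j - a k) * T j) \<le> (\<Sum>j<n. if j < k then a j - a k else 0)"
  proof (intro sum_mono)
    fix j assume "j \<in> {..<n}"
    then have j: "j < n" by simp
    show "(a j - a k) * T j \<le> (if j < k then a j - a k else 0)"
      using dec[of j k] dec[of k j] T[OF j] kn j
      by (cases "j < k") (auto intro: mult_left_le mult_nonpos_nonneg)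
  qed
  also have "\<dots> = (\<Sum>j<k. a j) - real k * a k"
  proof -
    have "(\<Sum>j<n. if j < k then a j - a k else 0) = (\<Sum>j<k. a j - a k)"
      by (rule sum.mono_neutral_cong_right) (use kn in auto)
    then show ?thesis by (simp add: sum_subtractf)
  qed
  finally have "(\<Sum>j<n. a j * T j) - a k * (\<Sum>j<n. T j) \<le> (\<Sum>j<k. a j) - real k * a k"
    by (simp add: left_diff_distrib sum_subtractf sum_distrib_left)
  moreover have "a k * (\<Sum>j<n. T j) \<le> a k * real k"
    using sumT nonneg[OF kn] by (rule mult_left_mono)
  ultimately show ?thesis by (simp add: mult.commute)
qed

text \<open>
  Bessel's inequality for the basis vector $e_i$, from the squared distance between $e_i$ and its
  projection onto the span of an orthonormal family.
\<close>

lemma bessel_coordinate: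
  fixes v :: "nat \<Rightarrow> 'j \<Rightarrow> real"
  assumes J: "finite J" and i: "i < d"
    and orth: "\<And>j j'. j \<in> J \<Longrightarrow> j' \<in> J \<Longrightarrow> (\<Sum>l<d. v l j * v l j') = (if j = j' then 1 else 0)"
  shows "(\<Sum>j\<in>J. (v i j)\<^sup>2) \<le> 1"
proof -
  define x where "x l = (\<Sum>j\<in>J. v i j * v l j)" for l
  define s where "s = (\<Sum>j\<in>J. (v i j)\<^sup>2)"
  have xi: "x i = s" by (simp add: x_def s_def power2_eq_square)
  have "(\<Sum>l<d. (x l)\<^sup>2) = (\<Sum>l<d. \<Sum>j\<in>J. \<Sum>j'\<in>J. v i j * v i j' * (v l j * v l j'))"
    unfolding x_def power2_eq_square sum_product by (intro sum.cong refl) (simp add: mult_ac)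
  also have "\<dots> = (\<Sum>j\<in>J. \<Sum>j'\<in>J. \<Sum>l<d. v i j * v i j' * (v l j * v l j'))"
    by (subst sum.swap, intro sum.cong refl, rule sum.swap)
  also have "\<dots> = (\<Sum>j\<in>J. \<Sum>j'\<in>J. if j' = j then (v i j)\<^sup>2 else 0)"
    by (intro sum.cong refl) (auto simp: sum_distrib_left[symmetric] orth power2_eq_square)
  also have "\<dots> = s" using J by (simp add: s_def)
  finally have xx: "(\<Sum>l<d. (x l)\<^sup>2) = s" .
  have "0 \<le> (\<Sum>l<d. ((if l = i then 1 else 0) - x l)\<^sup>2)" by (simp add: sum_nonneg)
  also have "\<dots> = (\<Sum>l<d. (if l = i then 1 - 2 * x i else 0) + (x l)\<^sup>2)"
    by (intro sum.cong) (auto simp: power2_eq_square algebra_simps)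
  also have "\<dots> = 1 - s" using i by (simp add: sum.distrib xx xi)
  finally show ?thesis by (simp add: s_def)
qed

text \<open>
  The Ky Fan inequality for $c c^T$ and the rows in \<open>K\<close>. The fraction \<open>T j\<close> of the
  squared norm of column \<open>j\<close> lying in these rows is at most 1, and by Bessel's inequality the
  fractions add up to at most \<open>card K\<close>.
\<close>

lemma row_mass_le_top_column_norms:
  fixes c :: "nat \<Rightarrow> nat \<Rightarrow> real" and a :: "nat \<Rightarrow> real"
  assumes gram: "\<And>j j'. j < p \<Longrightarrow> j' < p \<Longrightarrow> (\<Sum>i<d. c i j * c i j') = (if j = j' then a j else 0)"
    and dec: "\<And>i j. i \<le> j \<Longrightarrow> j < p \<Longrightarrow> a j \<le> a i"
    and K: "K \<subseteq> {..<d}"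
  shows "(\<Sum>i\<in>K. \<Sum>j<p. (c i j)\<^sup>2) \<le> (\<Sum>j<card K. if j < p then a j else 0)"
proof -
  have finK: "finite K" using K finite_subset by blast
  have norm: "(\<Sum>i<d. (c i j)\<^sup>2) = a j" if "j < p" for j
    using gram[OF that that] by (simp add: power2_eq_square)
  have a0: "a j \<ge> 0" if "j < p" for j
    unfolding norm[OF that, symmetric] by (simp add: sum_nonneg)
  have c0: "c i j = 0" if "j < p" "a j = 0" "i < d" for i j
    using norm[OF that(1)] that by (simp add: sum_nonneg_eq_0_iff)
  define b where "b j = (if j < p then a j else 0)" for j
  define T where "T j = (if j < p \<and> a j > 0 then (\<Sum>i\<in>K. (c i j)\<^sup>2) / a j else 0)" for j
  \<comment> \<open>There may be more rows in \<open>K\<close> than columns; \<open>b\<close> and \<open>T\<close> are padded with zeros to \<open>n\<close> entries.\<close>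
  define n where "n = max p (card K)"
  define J where "J = {j \<in> {..<p}. a j > 0}"
  have bT: "b j * T j = (\<Sum>i\<in>K. (c i j)\<^sup>2)" if "j < p" for j
  proof (cases "a j > 0")
    case False
    then have "a j = 0" using a0[OF that] by simp
    moreover have "(\<Sum>i\<in>K. (c i j)\<^sup>2) = 0"
      by (rule sum.neutral) (use c0[OF that \<open>a j = 0\<close>] K in auto)
    ultimately show ?thesis by (simp add: b_def)
  qed (use that in \<open>simp add: b_def T_def\<close>)
  have "(\<Sum>i\<in>K. \<Sum>j<p. (c i j)\<^sup>2) = (\<Sum>j<p. \<Sum>i\<in>K. (c i j)\<^sup>2)"
    by (rule sum.swap)
  also have "\<dots> = (\<Sum>j<n. b j * T j)"
    by (rule sum.mono_neutral_cong_left) (auto simp: n_def bT, auto simp: b_def)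
  also have "\<dots> \<le> (\<Sum>j<card K. b j)"
  proof (rule weighted_sum_le_top_sum)
    show "b j \<le> b i" if "i \<le> j" "j < n" for i j
      using that dec[of i j] a0[of i] by (auto simp: b_def)
    show "0 \<le> b j" for j using a0 by (simp add: b_def)
    show "0 \<le> T j" for j by (simp add: T_def sum_nonneg)
    show "T j \<le> 1" for j
    proof (cases "j < p \<and> a j > 0")
      case True
      have "(\<Sum>i\<in>K. (c i j)\<^sup>2) \<le> (\<Sum>i<d. (c i j)\<^sup>2)"
        using K by (intro sum_mono2) auto
      then show ?thesis using True norm by (simp add: T_def)
    qed (auto simp: T_def)
    have "(\<Sum>j<n. T j) = (\<Sum>j\<in>J. \<Sum>i\<in>K. (c i j / sqrt (a j))\<^sup>2)"
      by (rule sum.mono_neutral_cong_right)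
        (auto simp: n_def J_def T_def power_divide sum_divide_distrib)
    also have "\<dots> = (\<Sum>i\<in>K. \<Sum>j\<in>J. (c i j / sqrt (a j))\<^sup>2)"
      by (rule sum.swap)
    also have "\<dots> \<le> (\<Sum>i\<in>K. 1)"
    proof (intro sum_mono bessel_coordinate)
      fix i j j' assume "i \<in> K" and jj: "j \<in> J" "j' \<in> J"
      have "(\<Sum>l<d. c l j / sqrt (a j) * (c l j' / sqrt (a j'))) = (\<Sum>l<d. c l j * c l j') / (sqrt (a j) * sqrt (a j'))"
        by (simp add: sum_divide_distrib)
      then show "(\<Sum>l<d. c l j / sqrt (a j) * (c l j' / sqrt (a j'))) = (if j = j' then 1 else 0)"
        using jj gram[of j j'] by (auto simp: J_def)
    qed (use K in \<open>auto simp: J_def\<close>)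
    finally show "(\<Sum>j<n. T j) \<le> real (card K)" by simp
    show "card K \<le> n" by (simp add: n_def)
  qed
  finally show ?thesis by (simp add: b_def)
qed

lemma sum_lessThan_add:
  fixes f :: "nat \<Rightarrow> 'a :: comm_monoid_add"
  shows "(\<Sum>i<p + q. f i) = (\<Sum>i<p. f i) + (\<Sum>j<q. f (p + j))"
  by (induction q) (auto simp: add.assoc)

text \<open>
  In the eigenbases of the two diagonal blocks, $S$ becomes $C^T C$ with $C = D^{1/2} W^T U$, and its
  diagonal blocks become $L_1$ and $L_2$. So the columns of $C$ within one group are orthogonal,
  whereas $C C^T = D$. The Ky Fan inequality is applied to each group separately.
\<close>

lemma spectrum_majorised_by_block_spectra:
  assumes S: "S \<in> Gamma_set p q S1 S2" and od: "orth_diagonalises (p + q) S W D"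
    and od1: "ordered_eigendecomposition p S1 U1 L1"
    and od2: "ordered_eigendecomposition q S2 U2 L2"
  defines "\<mu> \<equiv> \<lambda>j. (if j < p then L1 $$ (j, j) else 0) + (if j < q then L2 $$ (j, j) else 0)"
  shows "K \<subseteq> {..<p + q} \<Longrightarrow> (\<Sum>i\<in>K. D $$ (i, i)) \<le> (\<Sum>j<card K. \<mu> j)"
    and "(\<Sum>i<p + q. D $$ (i, i)) = (\<Sum>j<p + q. \<mu> j)"
proof -
  let ?d = "p + q"
  have S_psd: "S \<in> psd_mats ?d" and Scar: "S \<in> carrier_mat ?d ?d" using S by (auto simp: Gamma_set_def psd_mats_def)
  obtain B C where split: "split_block S p p = (S1, B, C, S2)" using S by (auto simp: Gamma_set_def)
  have S1: "S1 \<in> carrier_mat p p" and B: "B \<in> carrier_mat p q" and C: "C \<in> carrier_mat q p"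
    and S2: "S2 \<in> carrier_mat q q" and Sblock: "S = four_block_mat S1 B C S2"
    using split_block[OF split, of q q] Scar by auto
  have oW: "orthogonal ?d W" and D: "D \<in> carrier_mat ?d ?d" "diagonal_mat D"
    and SD: "S = W * D * transpose_mat W" using od by (auto simp: orth_diagonalises_iff)
  have o1: "orthogonal p U1" and L1: "L1 \<in> carrier_mat p p" "diagonal_mat L1"
    and S1L: "S1 = U1 * L1 * transpose_mat U1" and dec1: "\<And>i j. i \<le> j \<Longrightarrow> j < p \<Longrightarrow> L1 $$ (j, j) \<le> L1 $$ (i, i)"
    using od1 by (auto simp: orth_diagonalises_iff ordered_eigendecomposition_def)
  have o2: "orthogonal q U2" and L2: "L2 \<in> carrier_mat q q" "diagonal_mat L2"
    and S2L: "S2 = U2 * L2 * transpose_mat U2" and dec2: "\<And>i j. i \<le> j \<Longrightarrow> j < q \<Longrightarrow> L2 $$ (j, j) \<le> L2 $$ (i, i)"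
    using od2 by (auto simp: orth_diagonalises_iff ordered_eigendecomposition_def)
  note W = orthogonalD[OF oW] and U1 = orthogonalD[OF o1] and U2 = orthogonalD[OF o2]
  let ?Z = "0\<^sub>m p q :: real mat" and ?Y = "0\<^sub>m q p :: real mat"
  have Z: "?Z \<in> carrier_mat p q" and Y: "?Y \<in> carrier_mat q p" by auto
  define U where "U = four_block_mat U1 ?Z ?Y U2"
  have oU: "orthogonal ?d U" unfolding U_def by (rule orthogonal_block_diag[OF o1 o2])
  note U = orthogonalD[OF oU]
  have Ut: "transpose_mat U = four_block_mat (transpose_mat U1) ?Z ?Y (transpose_mat U2)"
    unfolding U_def by (subst transpose_four_block_mat[OF U1(1) Z Y U2(1)]) simp
  define B' where "B' = transpose_mat U1 * B * U2"
  define C' where "C' = transpose_mat U2 * C * U1"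
  have B': "B' \<in> carrier_mat p q" and C': "C' \<in> carrier_mat q p"
    using U1 U2 B C by (auto simp: B'_def C'_def)
  have "transpose_mat U * S = four_block_mat (transpose_mat U1 * S1) (transpose_mat U1 * B) (transpose_mat U2 * C) (transpose_mat U2 * S2)"
    unfolding Ut Sblock using mult_four_block_mat[OF U1(2) Z Y U2(2) S1 B C S2] U1 U2 S1 S2 B C by simp
  then have "transpose_mat U * S * U = four_block_mat (transpose_mat U1 * S1 * U1) B' C' (transpose_mat U2 * S2 * U2)"
    unfolding U_def B'_def C'_def
    using mult_four_block_mat[OF mult_carrier_mat[OF U1(2) S1] mult_carrier_mat[OF U1(2) B]
        mult_carrier_mat[OF U2(2) C] mult_carrier_mat[OF U2(2) S2] U1(1) Z Y U2(1)] U1 U2 S1 S2 B C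
    by simp
  then have USU: "transpose_mat U * S * U = four_block_mat L1 B' C' L2"
    using transpose_conjugate[OF o1 L1(1) S1L] transpose_conjugate[OF o2 L2(1) S2L] by simp
  define G where "G = transpose_mat W * U"
  have oG: "orthogonal ?d G" unfolding G_def by (rule orthogonal_mult[OF orthogonal_transpose[OF oW] oU])
  note G = orthogonalD[OF oG]
  have GDG: "transpose_mat G * D * G = four_block_mat L1 B' C' L2"
  proof -
    have "transpose_mat G * D * G = transpose_mat U * (W * D * transpose_mat W) * U"
      unfolding G_def using transpose_mult[OF W(2) U(1)] W(1,2) U(1,2) D(1)
      by (simp add: assoc_mult_mat[of _ ?d ?d _ ?d _ ?d])
    then show ?thesis unfolding SD[symmetric] USU .
  qed
  have D0: "D $$ (i, i) \<ge> 0" if "i < ?d" for i using psd_diag_nonneg[OF S_psd od that] .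
  define c where "c i j = sqrt (D $$ (i, i)) * G $$ (i, j)" for i j
  have cc: "(\<Sum>i<?d. c i j * c i j') = four_block_mat L1 B' C' L2 $$ (j, j')" if "j < ?d" "j' < ?d" for j j'
  proof -
    have "(transpose_mat G * D * G) $$ (j, j') = (\<Sum>i<?d. D $$ (i, i) * (G $$ (i, j) * G $$ (i, j')))"
      using conjugate_diag_entry[OF G(2) D that] G(1) that by simp
    also have "\<dots> = (\<Sum>i<?d. c i j * c i j')"
      by (intro sum.cong refl) (use D0 in \<open>simp add: c_def\<close>)
    finally show ?thesis unfolding GDG by simp
  qed
  have gram1: "(\<Sum>i<?d. c i j * c i j') = (if j = j' then L1 $$ (j, j) else 0)" if "j < p" "j' < p" for j j'
    using cc[of j j'] that L1 L2 by (auto simp: diagonal_mat_def)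
  have gram2: "(\<Sum>i<?d. c i (p + j) * c i (p + j')) = (if j = j' then L2 $$ (j, j) else 0)" if "j < q" "j' < q" for j j'
    using cc[of "p + j" "p + j'"] that L1 L2 by (auto simp: diagonal_mat_def)
  have Di: "D $$ (i, i) = (\<Sum>j<p. (c i j)\<^sup>2) + (\<Sum>j<q. (c i (p + j))\<^sup>2)" if "i < ?d" for i
  proof -
    have "(\<Sum>j<?d. (c i j)\<^sup>2) = D $$ (i, i) * (\<Sum>j<?d. G $$ (i, j) * G $$ (i, j))"
      unfolding sum_distrib_left
      by (intro sum.cong refl) (use D0[OF that] in \<open>simp add: c_def power_mult_distrib power2_eq_square\<close>)
    also have "(\<Sum>j<?d. G $$ (i, j) * G $$ (i, j)) = 1"
      using orthogonal_col_sum[OF orthogonal_transpose[OF oG] that that] G(1) that by simp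
    finally show ?thesis by (simp add: sum_lessThan_add)
  qed
  show "(\<Sum>i\<in>K. D $$ (i, i)) \<le> (\<Sum>j<card K. \<mu> j)" if K: "K \<subseteq> {..<?d}"
  proof -
    have "(\<Sum>i\<in>K. D $$ (i, i)) = (\<Sum>i\<in>K. \<Sum>j<p. (c i j)\<^sup>2) + (\<Sum>i\<in>K. \<Sum>j<q. (c i (p + j))\<^sup>2)"
      unfolding sum.distrib[symmetric] by (intro sum.cong refl) (use K Di in auto)
    also have "\<dots> \<le> (\<Sum>j<card K. if j < p then L1 $$ (j, j) else 0) + (\<Sum>j<card K. if j < q then L2 $$ (j, j) else 0)"
      by (intro add_mono row_mass_le_top_column_norms[OF _ _ K]) (use gram1 gram2 dec1 dec2 in auto)
    also have "\<dots> = (\<Sum>j<card K. \<mu> j)" by (simp add: \<mu>_def sum.distrib)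
    finally show ?thesis .
  qed
  have "(\<Sum>i<?d. D $$ (i, i)) = (\<Sum>i<?d. \<Sum>j<p. (c i j)\<^sup>2) + (\<Sum>i<?d. \<Sum>j<q. (c i (p + j))\<^sup>2)"
    unfolding sum.distrib[symmetric] by (intro sum.cong refl) (use Di in auto)
  also have "\<dots> = (\<Sum>j<p. \<Sum>i<?d. c i j * c i j) + (\<Sum>j<q. \<Sum>i<?d. c i (p + j) * c i (p + j))"
    unfolding power2_eq_square by (intro arg_cong2[of _ _ _ _ plus] sum.swap)
  also have "\<dots> = (\<Sum>j<p. L1 $$ (j, j)) + (\<Sum>j<q. L2 $$ (j, j))"
    by (simp add: gram1 gram2)
  also have "(\<Sum>j<p. L1 $$ (j, j)) = (\<Sum>j<?d. if j < p then L1 $$ (j, j) else 0)"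
    by (rule sum.mono_neutral_cong_left) auto
  also have "(\<Sum>j<q. L2 $$ (j, j)) = (\<Sum>j<?d. if j < q then L2 $$ (j, j) else 0)"
    by (rule sum.mono_neutral_cong_left) auto
  finally show "(\<Sum>i<?d. D $$ (i, i)) = (\<Sum>j<?d. \<mu> j)"
    by (simp add: \<mu>_def sum.distrib)
qed

section \<open>Majorisation and the function x ln x\<close>

lemma x_ln_x_tangent:
  assumes "l > 0" "m \<ge> 0"
  shows "x_ln_x l + (ln l + 1) * (m - l) \<le> x_ln_x m"
proof (cases "m = 0")
  case True
  then show ?thesis using assms by (simp add: x_ln_x_def algebra_simps)
next
  case False
  then have m: "m > 0" using assms by simp
  have "ln (l / m) \<le> l / m - 1" using assms m by (intro ln_le_minus_one) simp
  then have "m * (ln l - ln m) \<le> m * (l / m - 1)"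
    using assms m by (intro mult_left_mono) (auto simp: ln_div)
  then show ?thesis using assms m by (simp add: x_ln_x_def algebra_simps)
qed

text \<open>Summation by parts, written as an induction: a partial sum of \<open>e\<close> is nonnegative, so
  lowering its weight from \<open>w n\<close> to \<open>w (Suc n)\<close> cannot increase the product.\<close>

lemma decreasing_weights_sum:
  fixes w e :: "nat \<Rightarrow> real"
  assumes "\<And>i j. i \<le> j \<Longrightarrow> j < Suc n \<Longrightarrow> w j \<le> w i"
    and "\<And>k. k \<le> Suc n \<Longrightarrow> 0 \<le> (\<Sum>i<k. e i)"
  shows "w n * (\<Sum>i<Suc n. e i) \<le> (\<Sum>i<Suc n. w i * e i)"
  using assms
proof (induction n)
  case (Suc n)
  have "w (Suc n) * (\<Sum>i<Suc n. e i) \<le> w n * (\<Sum>i<Suc n. e i)"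
    using Suc.prems(1)[of n "Suc n"] Suc.prems(2)[of "Suc n"] by (intro mult_right_mono) auto
  also have "\<dots> \<le> (\<Sum>i<Suc n. w i * e i)"
    using Suc.prems by (intro Suc.IH) auto
  finally show ?case by (simp add: algebra_simps)
qed simp

text \<open>
  The tangent at $l_i$ gives
  $\sum m_i \ln m_i - \sum l_i \ln l_i \ge \sum (\ln l_i + 1)(m_i - l_i)$, and the right-hand side is
  nonnegative since its weights decrease. The tangent is vertical at $0$, so this is done only for
  the first \<open>r\<close> indices, where $l_i > 0$. These already exhaust the total of $l$, hence by
  majorisation also that of $m$, and all later terms vanish on both sides.
\<close>

lemma sum_x_ln_x_mono_sorted:
  fixes l m :: "nat \<Rightarrow> real"
  assumes dec: "\<And>i j. i \<le> j \<Longrightarrow> j < d \<Longrightarrow> l j \<le> l i"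
    and l0: "\<And>i. i < d \<Longrightarrow> 0 \<le> l i" and m0: "\<And>i. i < d \<Longrightarrow> 0 \<le> m i"
    and major: "\<And>k. k \<le> d \<Longrightarrow> (\<Sum>i<k. l i) \<le> (\<Sum>i<k. m i)"
    and total: "(\<Sum>i<d. l i) = (\<Sum>i<d. m i)"
  shows "(\<Sum>i<d. x_ln_x (l i)) \<le> (\<Sum>i<d. x_ln_x (m i))"
proof -
  define r where "r = card {i \<in> {..<d}. l i > 0}"
  have pos: "{i \<in> {..<d}. l i > 0} = {..<r}"
  proof -
    define A where "A = {i \<in> {..<d}. l i > 0}"
    have fin: "finite A" by (simp add: A_def)
    have down: "i \<in> A" if "j \<in> A" "i \<le> j" for i j
      using that dec[of i j] by (fastforce simp: A_def)
    have "A = {..<card A}"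
    proof (cases "A = {}")
      case False
      have "A = {..Max A}" using down Max_in[OF fin False] Max_ge[OF fin] by auto
      then have "card A = Suc (Max A)" by (metis card_atMost)
      then show ?thesis using \<open>A = {..Max A}\<close> by (simp add: lessThan_Suc_atMost)
    qed simp
    then show ?thesis by (simp add: A_def r_def)
  qed
  have rd: "r \<le> d" using card_mono[of "{..<d}" "{i \<in> {..<d}. l i > 0}"] by (auto simp: r_def)
  have lpos: "l i > 0" if "i < r" for i using pos that by blast
  have lzero: "l i = 0" if "r \<le> i" "i < d" for i
    using pos that l0[of i] by (metis (no_types, lifting) leD lessThan_iff less_eq_real_def mem_Collect_eq)
  have lr: "(\<Sum>i<r. l i) = (\<Sum>i<d. l i)"
    by (rule sum.mono_neutral_left) (use rd lzero in auto)
  have split: "(\<Sum>i<d. f i) = (\<Sum>i<r. f i) + (\<Sum>i\<in>{r..<d}. f i)" for f :: "nat \<Rightarrow> real"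
    using rd by (metis atLeast0LessThan le0 sum.atLeastLessThan_concat)
  have "(\<Sum>i\<in>{r..<d}. m i) \<le> 0"
    using major[OF rd] split[of m] lr total by simp
  moreover have "(\<Sum>i\<in>{r..<d}. m i) \<ge> 0" using m0 by (intro sum_nonneg) auto
  ultimately have mr0: "(\<Sum>i\<in>{r..<d}. m i) = 0" by simp
  then have mzero: "m i = 0" if "r \<le> i" "i < d" for i
    using that m0 by (subst (asm) sum_nonneg_eq_0_iff) auto
  have mr: "(\<Sum>i<r. m i) = (\<Sum>i<r. l i)" using mr0 split[of m] lr total by simp
  have "0 \<le> (\<Sum>i<r. (ln (l i) + 1) * (m i - l i))"
  proof (cases r)
    case (Suc n)
    have "(ln (l n) + 1) * (\<Sum>i<Suc n. m i - l i) \<le> (\<Sum>i<Suc n. (ln (l i) + 1) * (m i - l i))"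
    proof (rule decreasing_weights_sum)
      show "ln (l j) + 1 \<le> ln (l i) + 1" if "i \<le> j" "j < Suc n" for i j
        using dec[of i j] lpos[of j] lpos[of i] rd that Suc by simp
      show "0 \<le> (\<Sum>i<k. m i - l i)" if "k \<le> Suc n" for k
        using major[of k] that rd Suc by (simp add: sum_subtractf)
    qed
    moreover have "(\<Sum>i<Suc n. m i - l i) = 0" unfolding sum_subtractf using mr Suc by simp
    ultimately show ?thesis using Suc by simp
  qed simp
  then have "(\<Sum>i<r. x_ln_x (l i)) \<le> (\<Sum>i<r. x_ln_x (l i) + (ln (l i) + 1) * (m i - l i))"
    by (simp add: sum.distrib)
  also have "\<dots> \<le> (\<Sum>i<r. x_ln_x (m i))"
    using lpos m0 rd by (intro sum_mono x_ln_x_tangent) auto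
  finally have "(\<Sum>i<r. x_ln_x (l i)) \<le> (\<Sum>i<r. x_ln_x (m i))" .
  moreover have "(\<Sum>i\<in>{r..<d}. x_ln_x (l i)) = (\<Sum>i\<in>{r..<d}. x_ln_x (m i))"
    by (intro sum.cong) (auto simp: lzero mzero)
  ultimately show ?thesis by (simp add: split)
qed

lemma sum_x_ln_x_mono:
  fixes l m :: "nat \<Rightarrow> real"
  assumes l0: "\<And>i. i < d \<Longrightarrow> 0 \<le> l i" and m0: "\<And>i. i < d \<Longrightarrow> 0 \<le> m i"
    and major: "\<And>K. K \<subseteq> {..<d} \<Longrightarrow> (\<Sum>i\<in>K. l i) \<le> (\<Sum>i<card K. m i)"
    and total: "(\<Sum>i<d. l i) = (\<Sum>i<d. m i)"
  shows "(\<Sum>i<d. x_ln_x (l i)) \<le> (\<Sum>i<d. x_ln_x (m i))"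
proof -
  define xs where "xs = map l [0..<d]"
  define ys where "ys = rev (sort xs)"
  have "mset ys = mset xs" by (simp add: ys_def)
  then obtain \<pi> where \<pi>: "\<pi> permutes {..<length xs}" and ys: "permute_list \<pi> xs = ys"
    by (rule mset_eq_permutation)
  have \<pi>: "\<pi> permutes {..<d}" using \<pi> by (simp add: xs_def)
  have ysi: "ys ! i = l (\<pi> i)" if "i < d" for i
    unfolding ys[symmetric] using that permutes_in_image[OF \<pi>, of i] \<pi>
    by (simp add: permute_list_nth xs_def)
  have reindex: "(\<Sum>i<d. f (l (\<pi> i))) = (\<Sum>i<d. f (l i))" for f :: "real \<Rightarrow> real"
    using sum.permute[OF \<pi>, of "\<lambda>i. f (l i)"] by (simp add: o_def)
  have "(\<Sum>i<d. x_ln_x (l (\<pi> i))) \<le> (\<Sum>i<d. x_ln_x (m i))"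
  proof (rule sum_x_ln_x_mono_sorted)
    show "l (\<pi> j) \<le> l (\<pi> i)" if "i \<le> j" "j < d" for i j
    proof -
      have "length ys = d" by (simp add: ys_def xs_def)
      moreover have "sorted (rev ys)" by (simp add: ys_def)
      ultimately have "ys ! j \<le> ys ! i" using that by (simp add: sorted_rev_nth_mono)
      then show ?thesis using that ysi by simp
    qed
    show "0 \<le> l (\<pi> i)" if "i < d" for i using that permutes_in_image[OF \<pi>, of i] l0 by simp
    show "(\<Sum>i<k. l (\<pi> i)) \<le> (\<Sum>i<k. m i)" if "k \<le> d" for k
    proof -
      have inj: "inj_on \<pi> {..<k}" using permutes_inj[OF \<pi>] by (rule inj_on_subset) simp
      have "\<pi> ` {..<k} \<subseteq> {..<d}" using permutes_in_image[OF \<pi>] that by fastforce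
      from major[OF this] show ?thesis by (simp add: sum.reindex[OF inj] card_image[OF inj])
    qed
  qed (use m0 total reindex[of "\<lambda>x. x"] in auto)
  then show ?thesis using reindex[of x_ln_x] by simp
qed

section \<open>The minimising matrix as a Gram matrix\<close>

lemma gram_psd:
  fixes N :: "real mat"
  assumes N: "N \<in> carrier_mat m n"
  shows "N * transpose_mat N \<in> psd_mats m"
proof -
  have Nt: "transpose_mat N \<in> carrier_mat n m" using N by simp
  have "v \<bullet> ((N * transpose_mat N) *\<^sub>v v) \<ge> 0" if v: "v \<in> carrier_vec m" for v
  proof -
    have Ntv: "transpose_mat N *\<^sub>v v \<in> carrier_vec n" using Nt v by auto
    have "v \<bullet> ((N * transpose_mat N) *\<^sub>v v) = v \<bullet> (N *\<^sub>v (transpose_mat N *\<^sub>v v))"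
      using assoc_mult_mat_vec[OF N Nt v] by simp
    also have "\<dots> = (transpose_mat N *\<^sub>v v) \<bullet> (transpose_mat N *\<^sub>v v)"
      using transpose_vec_mult_scalar[OF N Ntv v] by simp
    also have "\<dots> \<ge> 0" by (simp add: scalar_prod_def sum_nonneg)
    finally show ?thesis .
  qed
  moreover have "transpose_mat (N * transpose_mat N) = N * transpose_mat N"
    using transpose_mult[OF N Nt] by simp
  ultimately show ?thesis using N by (simp add: psd_mats_def)
qed

text \<open>
  The product of a square root $L^{1/2}$ with the truncated or padded identity of shape
  $m \times n$. Two such factors with a common number of columns line up the diagonals of two
  matrices of different sizes.
\<close>

definition sqrt_diag_rect :: "nat \<Rightarrow> nat \<Rightarrow> real mat \<Rightarrow> real mat" where
  "sqrt_diag_rect m n L = mat m n (\<lambda>(i, j). if i = j then sqrt (L $$ (i, i)) else 0)"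

lemma sqrt_diag_rect_carrier: "sqrt_diag_rect m n L \<in> carrier_mat m n"
  by (simp add: sqrt_diag_rect_def)

lemma sqrt_diag_rect_cross:
  assumes "p \<le> n" "q \<le> n" "i < p" "j < q"
  shows "(sqrt_diag_rect p n L * transpose_mat (sqrt_diag_rect q n M)) $$ (i, j)
    = (if i = j then sqrt (L $$ (i, i)) * sqrt (M $$ (j, j)) else 0)"
proof -
  have "(sqrt_diag_rect p n L * transpose_mat (sqrt_diag_rect q n M)) $$ (i, j)
    = (\<Sum>k<n. sqrt_diag_rect p n L $$ (i, k) * transpose_mat (sqrt_diag_rect q n M) $$ (k, j))"
    by (rule mult_mat_entry[of _ p n _ q]) (use assms in \<open>auto simp: sqrt_diag_rect_def\<close>)
  also have "\<dots> = (\<Sum>k<n. if k = i then (if i = j then sqrt (L $$ (i, i)) * sqrt (M $$ (j, j)) else 0) else 0)"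
    by (intro sum.cong) (use assms in \<open>auto simp: sqrt_diag_rect_def\<close>)
  finally show ?thesis using assms by simp
qed

lemma sqrt_diag_rect_gram:
  assumes "i < n" "j < n" and "\<And>k. k < p \<Longrightarrow> L $$ (k, k) \<ge> 0"
  shows "(transpose_mat (sqrt_diag_rect p n L) * sqrt_diag_rect p n L) $$ (i, j)
    = (if i = j \<and> i < p then L $$ (i, i) else 0)"
proof -
  have "(transpose_mat (sqrt_diag_rect p n L) * sqrt_diag_rect p n L) $$ (i, j)
    = (\<Sum>k<p. transpose_mat (sqrt_diag_rect p n L) $$ (i, k) * sqrt_diag_rect p n L $$ (k, j))"
    by (rule mult_mat_entry[of _ n p _ n]) (use assms in \<open>auto simp: sqrt_diag_rect_def\<close>)
  also have "\<dots> = (\<Sum>k<p. if k = i then (if i = j then L $$ (i, i) else 0) else 0)"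
    by (intro sum.cong) (use assms in \<open>auto simp: sqrt_diag_rect_def\<close>)
  finally show ?thesis by simp
qed

lemma sqrt_diag_Pi:
  assumes L: "L \<in> carrier_mat p p" and M: "M \<in> carrier_mat q q" and n: "n = p + q"
  shows "diag_fun sqrt L * Pi_mat p q * diag_fun sqrt M
    = sqrt_diag_rect p n L * transpose_mat (sqrt_diag_rect q n M)"
proof (rule eq_matI)
  let ?P = "Pi_mat p q"
  have P: "?P \<in> carrier_mat p q" by (simp add: Pi_mat_def split_block_def Let_def)
  have LP: "diag_fun sqrt L * ?P \<in> carrier_mat p q" by (rule mult_carrier_mat[OF diag_fun_carrier[OF L] P])
  fix i j assume "i < dim_row (sqrt_diag_rect p n L * transpose_mat (sqrt_diag_rect q n M))"
    "j < dim_col (sqrt_diag_rect p n L * transpose_mat (sqrt_diag_rect q n M))"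
  then have ij: "i < p" "j < q" by (auto simp: sqrt_diag_rect_def)
  have "(diag_fun sqrt L * ?P * diag_fun sqrt M) $$ (i, j) = sqrt (L $$ (i, i)) * ?P $$ (i, j) * sqrt (M $$ (j, j))"
    using diag_mult_right_entry[OF diag_fun_carrier[OF M] diagonal_diag_fun[OF M] LP ij]
      diag_mult_left_entry[OF diag_fun_carrier[OF L] diagonal_diag_fun[OF L] P ij]
      diag_fun_entry[OF L ij(1,1)] diag_fun_entry[OF M ij(2,2)] by simp
  also have "\<dots> = (if i = j then sqrt (L $$ (i, i)) * sqrt (M $$ (j, j)) else 0)"
    using ij by (simp add: Pi_mat_def split_block_def Let_def)
  finally show "(diag_fun sqrt L * ?P * diag_fun sqrt M) $$ (i, j)
    = (sqrt_diag_rect p n L * transpose_mat (sqrt_diag_rect q n M)) $$ (i, j)"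
    using sqrt_diag_rect_cross[of p n q i j L M] ij n by simp
qed (use L M in \<open>auto simp: sqrt_diag_rect_def diag_fun_def mat_diag_def\<close>)

text \<open>
  $N$ stacks $N_1 = U_1 K_1$ on $N_2 = U_2 K_2$, where $K_i$ is $L_i^{1/2}$ padded to $p + q$ columns.
  In $N N^T$ the blocks $N_i N_i^T$ and $N_1 N_2^T$ reproduce those of the candidate. In
  $N^T N = K_1^T K_1 + K_2^T K_2$ the orthogonal factors cancel and only diagonal matrices remain.
\<close>

lemma Sigma_m_gram:
  assumes S1: "S1 \<in> psd_mats p" and S2: "S2 \<in> psd_mats q"
    and od1: "orth_diagonalises p S1 U1 L1" and od2: "orth_diagonalises q S2 U2 L2"
  shows "\<exists>N \<in> carrier_mat (p + q) (p + q).
    Sigma_m S1 S2 (Psi_m p q U1 L1 U2 L2) = N * transpose_mat N \<and>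
    (\<forall>i<p + q. \<forall>j<p + q. (transpose_mat N * N) $$ (i, j) =
      (if i = j then (if i < p then L1 $$ (i, i) else 0) + (if i < q then L2 $$ (i, i) else 0) else 0))"
proof -
  define n where "n = p + q"
  have o1: "orthogonal p U1" and L1: "L1 \<in> carrier_mat p p" "diagonal_mat L1"
    and S1L: "S1 = U1 * L1 * transpose_mat U1" using od1 by (auto simp: orth_diagonalises_iff)
  have o2: "orthogonal q U2" and L2: "L2 \<in> carrier_mat q q" "diagonal_mat L2"
    and S2L: "S2 = U2 * L2 * transpose_mat U2" using od2 by (auto simp: orth_diagonalises_iff)
  note U1 = orthogonalD[OF o1] and U2 = orthogonalD[OF o2]
  have pos1: "L1 $$ (i, i) \<ge> 0" if "i < p" for i using psd_diag_nonneg[OF S1 od1 that] .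
  have pos2: "L2 $$ (i, i) \<ge> 0" if "i < q" for i using psd_diag_nonneg[OF S2 od2 that] .
  define K1 where "K1 = sqrt_diag_rect p n L1"
  define K2 where "K2 = sqrt_diag_rect q n L2"
  have K1: "K1 \<in> carrier_mat p n" and K2: "K2 \<in> carrier_mat q n"
    by (auto simp: K1_def K2_def sqrt_diag_rect_carrier)
  have K1t: "transpose_mat K1 \<in> carrier_mat n p" and K2t: "transpose_mat K2 \<in> carrier_mat n q"
    using K1 K2 by auto
  have K11: "K1 * transpose_mat K1 = L1"
    by (rule eq_matI) (use L1 K1 pos1 in \<open>auto simp: K1_def sqrt_diag_rect_cross n_def diagonal_mat_def simp del: index_mult_mat(1)\<close>)
  have K22: "K2 * transpose_mat K2 = L2"
    by (rule eq_matI) (use L2 K2 pos2 in \<open>auto simp: K2_def sqrt_diag_rect_cross n_def diagonal_mat_def simp del: index_mult_mat(1)\<close>)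
  define N1 where "N1 = U1 * K1"
  define N2 where "N2 = U2 * K2"
  have N1: "N1 \<in> carrier_mat p n" and N2: "N2 \<in> carrier_mat q n"
    using U1 U2 K1 K2 by (auto simp: N1_def N2_def)
  have N1t: "transpose_mat N1 = transpose_mat K1 * transpose_mat U1"
    and N2t: "transpose_mat N2 = transpose_mat K2 * transpose_mat U2"
    using transpose_mult[OF U1(1) K1] transpose_mult[OF U2(1) K2] by (auto simp: N1_def N2_def)
  have N1c: "transpose_mat N1 \<in> carrier_mat n p" and N2c: "transpose_mat N2 \<in> carrier_mat n q"
    using N1 N2 by auto
  have N11: "N1 * transpose_mat N1 = S1"
  proof -
    have "N1 * transpose_mat N1 = U1 * (K1 * transpose_mat K1) * transpose_mat U1"
      unfolding N1t unfolding N1_def using U1(1,2) K1 K1t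
      by (simp add: assoc_mult_mat[of _ p p _ p _ p] assoc_mult_mat[of _ p p _ n _ p] assoc_mult_mat[of _ p n _ p _ p])
    then show ?thesis unfolding K11 S1L .
  qed
  have N22: "N2 * transpose_mat N2 = S2"
  proof -
    have "N2 * transpose_mat N2 = U2 * (K2 * transpose_mat K2) * transpose_mat U2"
      unfolding N2t unfolding N2_def using U2(1,2) K2 K2t
      by (simp add: assoc_mult_mat[of _ q q _ q _ q] assoc_mult_mat[of _ q q _ n _ q] assoc_mult_mat[of _ q n _ q _ q])
    then show ?thesis unfolding K22 S2L .
  qed
  let ?Psi = "Psi_m p q U1 L1 U2 L2"
  have N12: "N1 * transpose_mat N2 = ?Psi"
  proof -
    have P: "Pi_mat p q \<in> carrier_mat p q" by (simp add: Pi_mat_def split_block_def Let_def)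
    note fL = diag_fun_carrier[OF L1(1), of sqrt] diag_fun_carrier[OF L2(1), of sqrt]
    have "N1 * transpose_mat N2 = U1 * (K1 * transpose_mat K2) * transpose_mat U2"
      unfolding N2t unfolding N1_def using U1(1,2) U2(1,2) K1 K2t
      by (simp add: assoc_mult_mat[of _ p p _ n _ q] assoc_mult_mat[of _ p n _ q _ q] assoc_mult_mat[of _ p p _ q _ q])
    also have "K1 * transpose_mat K2 = diag_fun sqrt L1 * Pi_mat p q * diag_fun sqrt L2"
      unfolding K1_def K2_def by (rule sqrt_diag_Pi[OF L1(1) L2(1) n_def, symmetric])
    also have "U1 * (diag_fun sqrt L1 * Pi_mat p q * diag_fun sqrt L2) * transpose_mat U2 = ?Psi"
      unfolding Psi_m_def using U1(1) U2(2) P fL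
      by (simp add: assoc_mult_mat[of _ p p _ p _ q] assoc_mult_mat[of _ p p _ q _ q] assoc_mult_mat[of _ p q _ q _ q])
    finally show ?thesis .
  qed
  have N21: "N2 * transpose_mat N1 = transpose_mat ?Psi"
    unfolding N12[symmetric] using transpose_mult[OF N1 N2c] by simp
  have c1: "S1 \<in> carrier_mat p p" and c2: "S2 \<in> carrier_mat q q" and cPsi: "?Psi \<in> carrier_mat p q"
    unfolding N11[symmetric] N22[symmetric] N12[symmetric] using N1 N2 N1c N2c by auto
  have G1: "transpose_mat N1 * N1 = transpose_mat K1 * K1"
  proof -
    have "transpose_mat N1 * N1 = transpose_mat K1 * ((transpose_mat U1 * U1) * K1)"
      unfolding N1t unfolding N1_def using U1(1,2) K1 K1t
      by (simp add: assoc_mult_mat[of _ n p _ p _ n] assoc_mult_mat[of _ p p _ p _ n])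
    then show ?thesis unfolding U1(3) using K1 by simp
  qed
  have G2: "transpose_mat N2 * N2 = transpose_mat K2 * K2"
  proof -
    have "transpose_mat N2 * N2 = transpose_mat K2 * ((transpose_mat U2 * U2) * K2)"
      unfolding N2t unfolding N2_def using U2(1,2) K2 K2t
      by (simp add: assoc_mult_mat[of _ n q _ q _ n] assoc_mult_mat[of _ q q _ q _ n])
    then show ?thesis unfolding U2(3) using K2 by simp
  qed
  let ?Z = "0\<^sub>m p 0 :: real mat" and ?Y = "0\<^sub>m q 0 :: real mat"
  have Z: "?Z \<in> carrier_mat p 0" and Y: "?Y \<in> carrier_mat q 0"
    and Z': "0\<^sub>m 0 p \<in> carrier_mat 0 p" and Y': "0\<^sub>m 0 q \<in> carrier_mat 0 q" by auto
  \<comment> \<open>Stacking is expressed by block matrices whose right-hand blocks have no columns.\<close>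
  define N where "N = four_block_mat N1 ?Z N2 ?Y"
  have Ncar: "N \<in> carrier_mat (p + q) n" unfolding N_def using four_block_carrier_mat[OF N1 Y] by simp
  have Nt: "transpose_mat N = four_block_mat (transpose_mat N1) (transpose_mat N2) (0\<^sub>m 0 p) (0\<^sub>m 0 q)"
    unfolding N_def by (subst transpose_four_block_mat[OF N1 Z N2 Y]) simp
  have "N * transpose_mat N = four_block_mat S1 ?Psi (transpose_mat ?Psi) S2"
    unfolding Nt unfolding N_def
    by (subst mult_four_block_mat[OF N1 Z N2 Y N1c N2c Z' Y'])
      (use c1 c2 cPsi in \<open>simp add: N11 N12 N21 N22\<close>)
  then have 1: "Sigma_m S1 S2 ?Psi = N * transpose_mat N" by (simp add: Sigma_m_def)
  have 2: "(transpose_mat N * N) $$ (i, j) = (if i = j then (if i < p then L1 $$ (i, i) else 0) + (if i < q then L2 $$ (i, i) else 0) else 0)"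
    if ij: "i < n" "j < n" for i j
  proof -
    have "(transpose_mat N * N) $$ (i, j) = (transpose_mat N1 * N1 + transpose_mat N2 * N2) $$ (i, j)"
      unfolding Nt unfolding N_def
      by (subst mult_four_block_mat[OF N1c N2c Z' Y' N1 Z N2 Y], subst index_mat_four_block)
        (use N1 N2 ij in auto)
    also have "\<dots> = (transpose_mat K1 * K1) $$ (i, j) + (transpose_mat K2 * K2) $$ (i, j)"
      unfolding G1 G2 using K1 K2 ij by simp
    finally show ?thesis
      unfolding K1_def K2_def using sqrt_diag_rect_gram[OF ij, of p L1] sqrt_diag_rect_gram[OF ij, of q L2] pos1 pos2
      by simp
  qed
  show ?thesis using Ncar 1 2 unfolding n_def by blast
qed

section \<open>Minimality of the entropy\<close>

theorem mainTheorem3: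
  fixes p q :: nat and S1 S2 U1 L1 U2 L2 :: "real mat"
  assumes "p \<ge> 1" and "q \<ge> 1"
    and "S1 \<in> psd_mats p" and "S2 \<in> psd_mats q"
    and "ordered_eigendecomposition p S1 U1 L1"
    and "ordered_eigendecomposition q S2 U2 L2"
  shows "is_arg_min vN_entropy (\<lambda>S. S \<in> Gamma_set p q S1 S2)
           (Sigma_m S1 S2 (Psi_m p q U1 L1 U2 L2))
       \<and> (\<forall>S \<in> Gamma_set p q S1 S2. vN_entropy S = - eigenvalue_sum x_ln_x S)"
proof -
  let ?d = "p + q"
  let ?Sm = "Sigma_m S1 S2 (Psi_m p q U1 L1 U2 L2)"
  have od1: "orth_diagonalises p S1 U1 L1" and od2: "orth_diagonalises q S2 U2 L2"
    using assms(5,6) by (auto simp: ordered_eigendecomposition_def)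
  define \<mu> where "\<mu> j = (if j < p then L1 $$ (j, j) else 0) + (if j < q then L2 $$ (j, j) else 0)" for j
  have \<mu>0: "\<mu> j \<ge> 0" for j
    using psd_diag_nonneg[OF assms(3) od1] psd_diag_nonneg[OF assms(4) od2] by (simp add: \<mu>_def)
  have diag: "\<exists>W D. orth_diagonalises ?d S W D" if "S \<in> psd_mats ?d" for S
    using that real_spectral_theorem[of S ?d] by (auto simp: psd_mats_def)
  have x_ln_x: "x_ln_x = (\<lambda>x. x * ln x)" by (auto simp: x_ln_x_def)
  obtain N where N: "N \<in> carrier_mat ?d ?d" and SmN: "?Sm = N * transpose_mat N"
    and gram: "\<And>i j. i < ?d \<Longrightarrow> j < ?d \<Longrightarrow> (transpose_mat N * N) $$ (i, j) = (if i = j then \<mu> i else 0)"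
    using Sigma_m_gram[OF assms(3,4) od1 od2] unfolding \<mu>_def by blast
  have Sm_psd: "?Sm \<in> psd_mats ?d" unfolding SmN by (rule gram_psd[OF N])
  have c1: "S1 \<in> carrier_mat p p" and c2: "S2 \<in> carrier_mat q q" using assms(3,4) by (auto simp: psd_mats_def)
  have "fst (split_block ?Sm p p) = S1"
    using c1 c2 by (auto simp: split_block_def Let_def Sigma_m_def intro!: eq_matI)
  moreover have "snd (snd (snd (split_block ?Sm p p))) = S2"
    using c1 c2 by (auto simp: split_block_def Let_def Sigma_m_def intro!: eq_matI)
  ultimately have Sm: "?Sm \<in> Gamma_set p q S1 S2"
    using Sm_psd unfolding Gamma_set_def by (cases "split_block ?Sm p p") auto
  have Sm_ent: "vN_entropy ?Sm = - (\<Sum>j<?d. x_ln_x (\<mu> j))"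
  proof -
    obtain W D where od: "orth_diagonalises ?d ?Sm W D" using diag[OF Sm_psd] by blast
    show ?thesis
      unfolding vN_entropy_def trace_sym_mat_fun[OF od]
      using trace_fun_gram_swap[OF od[unfolded SmN] N gram, of ln] by (simp add: x_ln_x)
  qed
  have bound: "vN_entropy ?Sm \<le> vN_entropy S" if S: "S \<in> Gamma_set p q S1 S2" for S
  proof -
    have psd: "S \<in> psd_mats ?d" using S by (simp add: Gamma_set_def)
    obtain W D where od: "orth_diagonalises ?d S W D" using diag[OF psd] by blast
    note maj = spectrum_majorised_by_block_spectra[OF S od assms(5,6), folded \<mu>_def]
    have "(\<Sum>i<?d. x_ln_x (D $$ (i, i))) \<le> (\<Sum>j<?d. x_ln_x (\<mu> j))"
      by (rule sum_x_ln_x_mono) (use maj psd_diag_nonneg[OF psd od] \<mu>0 in auto)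
    moreover have "vN_entropy S = - (\<Sum>i<?d. x_ln_x (D $$ (i, i)))"
      unfolding vN_entropy_def trace_sym_mat_fun[OF od] ..
    ultimately show ?thesis using Sm_ent by simp
  qed
  have "vN_entropy S = - eigenvalue_sum x_ln_x S" if "S \<in> Gamma_set p q S1 S2" for S
  proof -
    have "S \<in> psd_mats ?d" using that by (simp add: Gamma_set_def)
    then obtain W D where od: "orth_diagonalises ?d S W D" using diag by blast
    show ?thesis unfolding vN_entropy_def trace_sym_mat_fun[OF od] eigenvalue_sum_diag[OF od] by simp
  qed
  then show ?thesis using Sm bound by (auto simp: is_arg_min_def not_less)
qed

end
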